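(* Let $n\geq 3$. (i) Let $H$ be an $n\times n$ unreduced upper Hessenberg $0/1$-matrix whose columns together with the origin are the $n+1$ vertices of an $n$-simplex in $[0,1]^n$ with acute dihedral angles only; equivalently, $G=H^\top H$ is invertible, every off-diagonal entry of $G^{-1}$ is negative and every row sum of $G^{-1}$ is positive. Then, possibly after exchanging its first two rows and/or its last two columns, $H$ is equal to the matrix $H_\lambda$ for some composition $\lambda=\langle\lambda_1,\dots,\lambda_k\rangle$ of $n-1$ with $\lambda_1\geq 2$ and $\lambda_k\geq 2$. (ii) For every such composition $\lambda$, $$|\det(H_\lambda)|=f_k,\qquad\text{where}\qquad \frac{f_k}{g_k}=\lambda_1+\cfrac{1}{\lambda_2+\cfrac{1}{\ddots+\cfrac{1}{\lambda_k}}},\quad \gcd(f_k,g_k)=1 .$$ (iii) Conversely, for every such composition $\lambda$ the Gramian $H_\lambda^\top H_\lambda$ is strictly ultrametric, which implies that the columns of $H_\lambda$ together with the origin are the vertices of an acute $0/1$-simplex.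
   Context: An $n\times n$ matrix $H=(h_{ij})$ is unreduced upper Hessenberg if $h_{ij}=0$ whenever $i>j+1$ and $h_{j+1,j}\neq 0$ for all $j$. A composition of an integer $m$ into $k$ parts is an ordered tuple $\langle\lambda_1,\dots,\lambda_k\rangle$ of positive integers with $\lambda_1+\dots+\lambda_k=m$. Definition of $H_\lambda$: let $\lambda=\langle\lambda_1,\dots,\lambda_k\rangle$ be a composition of $n-1$ with $\lambda_1,\lambda_k\geq 2$. Partition the rows $1,\dots,n$ into consecutive blocks $R_0,R_1,\dots,R_k$, where $R_0=\{1\}$ and $R_j$ ($j\geq1$) consists of the next $\lambda_j$ rows; partition the columns $1,\dots,n$ into consecutive blocks $C_1,\dots,C_k,C_{k+1}$, where $C_j$ ($j\le k$) has $\lambda_j$ columns and $C_{k+1}=\{n\}$. $H_\lambda$ is the $n\times n$ $0/1$-matrix whose block $(R_j,C_j)$ is the identity matrix $I_{\lambda_j}$ for $1\leq j\leq k$, whose blocks $(R_i,C_j)$ with $i>j$ are zero, and whose blocks $(R_i,C_j)$ with $0\le i<j\le k+1$ consist entirely of ones if $j-i$ is odd and entirely of zeros if $j-i$ is even. (E.g. for $\lambda=\langle 2\rangle$, $H_\lambda$ has rows $(1,1,0),(1,0,1),(0,1,1)$.) A symmetric matrix is called strictly ultrametric (in the sense used here) if each of its $3\times3$ principal submatrices is, after a simultaneous permutation of rows and columns, of the form $\begin{bmatrix} d&b&a\\ b&c&a\\ a&a&f\end{bmatrix}$ with $a\leq b<c\leq d$ and $a<f$. A $0/1$-simplex is acute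 if all its dihedral angles are acute; for a simplex with the origin as a vertex and other vertices the columns of $P$, this is equivalent to $G=P^\top P$ being invertible with $G^{-1}$ having negative off-diagonal entries and positive row sums. *)

theory Defs
  imports "Jordan_Normal_Form.Determinant"
begin

text \<open>All matrices are Jordan_Normal_Form matrices over the reals; indices are 0-based,
  i.e. paper row/column i corresponds to index i-1.\<close>

definition unreduced_hessenberg :: "real mat \<Rightarrow> bool" where
  "unreduced_hessenberg H \<longleftrightarrow>
     (\<forall>i j. i < dim_row H \<and> j < dim_col H \<and> i > j + 1 \<longrightarrow> H $$ (i, j) = 0) \<and>
     (\<forall>j. j + 1 < dim_row H \<and> j < dim_col H \<longrightarrow> H $$ (j + 1, j) \<noteq> 0)"

definition zero_one_mat :: "real mat \<Rightarrow> bool" where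
  "zero_one_mat H \<longleftrightarrow> (\<forall>i j. i < dim_row H \<and> j < dim_col H \<longrightarrow> H $$ (i, j) \<in> {0, 1})"

definition gram :: "real mat \<Rightarrow> real mat" where
  "gram P = transpose_mat P * P"

text \<open>The simplex with vertices the origin and the columns of the n x n matrix P is acute:
  G = P^T P is invertible, its inverse has negative off-diagonal entries and positive row sums.\<close>
definition acute_simplex :: "real mat \<Rightarrow> bool" where
  "acute_simplex P \<longleftrightarrow> square_mat P \<and>
     (\<exists>Gi. Gi \<in> carrier_mat (dim_col P) (dim_col P) \<and>
        inverts_mat (gram P) Gi \<and> inverts_mat Gi (gram P) \<and>
        (\<forall>i j. i < dim_col P \<and> j < dim_col P \<and> i \<noteq> j \<longrightarrow> Gi $$ (i, j) < 0) \<and>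
        (\<forall>i < dim_col P. (\<Sum>j < dim_col P. Gi $$ (i, j)) > 0))"

definition good_composition :: "nat \<Rightarrow> nat list \<Rightarrow> bool" where
  "good_composition m lam \<longleftrightarrow> lam \<noteq> [] \<and> (\<forall>x \<in> set lam. x > 0) \<and> sum_list lam = m \<and>
     hd lam \<ge> 2 \<and> last lam \<ge> 2"

text \<open>Row block (0-based row index i): 0 for i = 0, and j (1..k) when
  lam_1+...+lam_(j-1) < i <= lam_1+...+lam_j.\<close>
definition row_block :: "nat list \<Rightarrow> nat \<Rightarrow> nat" where
  "row_block lam i = card {j. j < length lam \<and> sum_list (take j lam) < i}"

text \<open>Column block (0-based column index c): j (1..k) when
  lam_1+...+lam_(j-1) <= c < lam_1+...+lam_j, and k+1 for the last column c = n-1.\<close>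
definition col_block :: "nat list \<Rightarrow> nat \<Rightarrow> nat" where
  "col_block lam c = card {j. j \<le> length lam \<and> sum_list (take j lam) \<le> c}"

definition H_lam :: "nat list \<Rightarrow> real mat" where
  "H_lam lam = mat (sum_list lam + 1) (sum_list lam + 1) (\<lambda>(i, c).
     (if row_block lam i = col_block lam c then (if i = c + 1 then 1 else 0)
      else if row_block lam i > col_block lam c then 0
      else if odd (col_block lam c - row_block lam i) then 1 else 0))"

definition swap_rows_cols :: "bool \<Rightarrow> bool \<Rightarrow> real mat \<Rightarrow> real mat" where
  "swap_rows_cols r c H = mat (dim_row H) (dim_col H) (\<lambda>(i, j).
     H $$ ((if r \<and> i = 0 then 1 else if r \<and> i = 1 then 0 else i),
           (if c \<and> j = dim_col H - 1 then dim_col H - 2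
            else if c \<and> j = dim_col H - 2 then dim_col H - 1 else j)))"

fun cont_frac :: "nat list \<Rightarrow> real" where
  "cont_frac [] = 0"
| "cont_frac [x] = real x"
| "cont_frac (x # xs) = real x + 1 / cont_frac xs"

text \<open>Strictly ultrametric symmetric matrix: every 3x3 principal submatrix is, after a
  simultaneous permutation (indices p,q,r), of the form [[d,b,a],[b,c,a],[a,a,f]] with
  a <= b < c <= d and a < f.\<close>
definition strictly_ultrametric :: "real mat \<Rightarrow> bool" where
  "strictly_ultrametric G \<longleftrightarrow> square_mat G \<and> transpose_mat G = G \<and>
     (\<forall>i j k. i < dim_row G \<and> j < dim_row G \<and> k < dim_row G \<and> i \<noteq> j \<and> j \<noteq> k \<and> i \<noteq> k \<longrightarrow>
       (\<exists>p q r. {p, q, r} = {i, j, k} \<and>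
          G $$ (p, r) = G $$ (q, r) \<and>
          G $$ (p, r) \<le> G $$ (p, q) \<and> G $$ (p, q) < G $$ (q, q) \<and> G $$ (q, q) \<le> G $$ (p, p) \<and>
          G $$ (p, r) < G $$ (r, r)))"

end

theory Submission
  imports Defs
begin

text \<open>(i) If the simplex is acute, the inverse of \<open>H\<close> is positive exactly where the transpose of \<open>H\<close>
  has a one and negative elsewhere, so no row of \<open>H\<close> (as a set of columns) is contained in or disjoint
  from another. Read from the bottom right corner upwards, this determines an unreduced Hessenberg
  matrix: restricted to the columns from \<open>m\<close> on, each row above row \<open>Suc m\<close> equals a fixed vector
  or its complement, and the only choice is whether row \<open>Suc m\<close> prolongs the current block or opens
  a new one.

  (ii) \<open>H_lam\<close> is multiplied by a unit upper triangular matrix whose last column is orthogonal to all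
  rows of \<open>H_lam\<close> but the first. The only remaining entry of the last column of the product is, up to
  sign, a continuant.

  (iii) The Gramian minus the all-ones matrix is ultrametric. An ultrametric matrix splits, after
  subtraction of its minimal entry, into a direct sum of smaller ones, and adding back the constant
  is a rank one update that preserves diagonally dominant M-matrix inverses.\<close>

section \<open>Block recursion\<close>

lemma row_block_Nil [simp]: "row_block [] i = 0"
  by (simp add: row_block_def)

lemma row_block_zero [simp]: "row_block lam 0 = 0"
  by (simp add: row_block_def)

lemma row_block_Cons:
  assumes "0 < i"
  shows "row_block (a # lam) i = Suc (row_block lam (i - a))"
proof -
  let ?A = "{j. j < length lam \<and> sum_list (take j lam) < i - a}"
  have "{j. j < length (a # lam) \<and> sum_list (take j (a # lam)) < i} = insert 0 (Suc ` ?A)"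
  proof (intro Set.set_eqI)
    fix j show "j \<in> {j. j < length (a # lam) \<and> sum_list (take j (a # lam)) < i} \<longleftrightarrow>
        j \<in> insert 0 (Suc ` ?A)"
      using assms by (cases j) auto
  qed
  moreover have "card (insert 0 (Suc ` ?A)) = Suc (card ?A)"
    by (subst card_insert_disjoint) (auto simp: card_image)
  ultimately show ?thesis by (simp add: row_block_def)
qed

lemma col_block_Nil [simp]: "col_block [] c = 1"
  by (simp add: col_block_def)

lemma col_block_Cons:
  "col_block (a # lam) c = (if c < a then 1 else Suc (col_block lam (c - a)))"
proof -
  let ?A = "{j. j \<le> length lam \<and> a + sum_list (take j lam) \<le> c}"
  have "{j. j \<le> length (a # lam) \<and> sum_list (take j (a # lam)) \<le> c} = insert 0 (Suc ` ?A)"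
  proof (intro Set.set_eqI)
    fix j show "j \<in> {j. j \<le> length (a # lam) \<and> sum_list (take j (a # lam)) \<le> c} \<longleftrightarrow>
        j \<in> insert 0 (Suc ` ?A)"
      by (cases j) auto
  qed
  moreover have "card (insert 0 (Suc ` ?A)) = Suc (card ?A)"
    by (subst card_insert_disjoint) (auto simp: card_image)
  moreover have "?A = (if c < a then {} else {j. j \<le> length lam \<and> sum_list (take j lam) \<le> c - a})"
    by auto
  ultimately show ?thesis by (simp add: col_block_def)
qed

lemma col_block_pos: "0 < col_block lam c"
  by (cases lam) (auto simp: col_block_Cons)

lemma dim_H_lam [simp]:
  "dim_row (H_lam lam) = Suc (sum_list lam)" "dim_col (H_lam lam) = Suc (sum_list lam)"
  by (simp_all add: H_lam_def)

lemma H_lam_carrier: "H_lam lam \<in> carrier_mat (Suc (sum_list lam)) (Suc (sum_list lam))"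
  by (rule carrier_matI) simp_all

lemma H_lam_Nil: "H_lam [] $$ (0, 0) = 1"
  by (simp add: H_lam_def)

text \<open>Truncated subtraction sends the rows \<open>1, \<dots>, a\<close> of the first block to row 0 of the
  smaller matrix.\<close>

lemma H_lam_Cons:
  assumes "i \<le> a + sum_list lam" "c \<le> a + sum_list lam"
  shows "H_lam (a # lam) $$ (i, c) =
    (if c < a then (if i = 0 \<or> i = Suc c then 1 else 0)
     else if i = 0 then 1 - H_lam lam $$ (0, c - a)
     else H_lam lam $$ (i - a, c - a))"
proof (cases "i = 0")
  case True
  then show ?thesis
    using assms col_block_pos[of lam "c - a"]
    by (auto simp: H_lam_def col_block_Cons)
next
  case False
  show ?thesis
  proof (cases "c < a")
    case True
    with False assms show ?thesis
      by (auto simp: H_lam_def col_block_Cons row_block_Cons)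
  next
    case c: False
    show ?thesis
    proof (cases "i \<le> a")
      case True
      with False assms c show ?thesis using col_block_pos[of lam "c - a"]
        by (auto simp: H_lam_def col_block_Cons row_block_Cons)
    next
      case i: False
      then have "(i = Suc c) = (i - a = Suc (c - a))" "i - a \<le> sum_list lam" "c - a \<le> sum_list lam"
        using assms c by auto
      with False assms c show ?thesis
        by (simp add: H_lam_def col_block_Cons row_block_Cons)
    qed
  qed
qed

section \<open>Entries of \<open>H_lam\<close>, and its extensions by one row and column at the
  upper left\<close>

lemma H_lam_01:
  assumes "i \<le> sum_list lam" "c \<le> sum_list lam"
  shows "H_lam lam $$ (i, c) = 0 \<or> H_lam lam $$ (i, c) = 1"
  using assms by (auto simp: H_lam_def)

lemma H_lam_subdiag: "i < sum_list lam \<Longrightarrow> H_lam lam $$ (Suc i, i) = 1"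
  by (induction lam arbitrary: i) (auto simp: H_lam_Cons Suc_diff_le)

lemma H_lam_low:
  "i \<le> sum_list lam \<Longrightarrow> Suc c < i \<Longrightarrow> H_lam lam $$ (i, c) = 0"
proof (induction lam arbitrary: i c)
  case (Cons a lam)
  have "H_lam lam $$ (i - a, c - a) = 0" if "\<not> c < a"
    using Cons.prems that by (intro Cons.IH) auto
  with Cons.prems show ?case by (auto simp: H_lam_Cons)
qed simp

text \<open>A new first part 1 leaves the smaller matrix intact: its row 0 becomes the only row of
  the new block, and its complement goes on top.\<close>

lemma H_lam_new_block:
  "H_lam (Suc 0 # lam) $$ (0, 0) = 1"
  "c \<le> sum_list lam \<Longrightarrow> H_lam (Suc 0 # lam) $$ (0, Suc c) = 1 - H_lam lam $$ (0, c)"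
  "i \<le> sum_list lam \<Longrightarrow> H_lam (Suc 0 # lam) $$ (Suc i, 0) = (if i = 0 then 1 else 0)"
  "\<lbrakk>i \<le> sum_list lam; c \<le> sum_list lam\<rbrakk> \<Longrightarrow> H_lam (Suc 0 # lam) $$ (Suc i, Suc c) = H_lam lam $$ (i, c)"
  by (simp_all add: H_lam_Cons)

text \<open>Prolonging the first part reverses these roles: the old row 0 stays on top and its
  complement becomes row 1.\<close>

lemma H_lam_grow_block:
  "H_lam (Suc a # lam) $$ (0, 0) = 1"
  "c \<le> a + sum_list lam \<Longrightarrow> H_lam (Suc a # lam) $$ (0, Suc c) = H_lam (a # lam) $$ (0, c)"
  "i \<le> a + sum_list lam \<Longrightarrow> H_lam (Suc a # lam) $$ (Suc i, 0) = (if i = 0 then 1 else 0)"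
  "\<lbrakk>i \<le> a + sum_list lam; c \<le> a + sum_list lam\<rbrakk> \<Longrightarrow> H_lam (Suc a # lam) $$ (Suc i, Suc c) =
      (if i = 0 then 1 - H_lam (a # lam) $$ (0, c) else H_lam (a # lam) $$ (i, c))"
  by (auto simp: H_lam_Cons)

text \<open>Both matrices extend \<open>H_lam (a # lam)\<close> by one row and column, and both of
  their top rows begin with 1, so only the order of a row and its complement differs. This removes a
  leading part 1 in the classification.\<close>

lemma swap_rows_H_lam:
  "swap_rows_cols True False (H_lam (Suc 0 # a # lam)) = H_lam (Suc a # lam)"
proof (intro eq_matI)
  fix i c assume "i < dim_row (H_lam (Suc a # lam))" "c < dim_col (H_lam (Suc a # lam))"
  then have ic: "i \<le> Suc (a + sum_list lam)" "c \<le> Suc (a + sum_list lam)" by auto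
  have swap: "swap_rows_cols True False (H_lam (Suc 0 # a # lam)) $$ (i, c) =
      H_lam (Suc 0 # a # lam) $$ (if i = 0 then Suc 0 else if i = Suc 0 then 0 else i, c)"
    using ic by (simp add: swap_rows_cols_def)
  show "swap_rows_cols True False (H_lam (Suc 0 # a # lam)) $$ (i, c) = H_lam (Suc a # lam) $$ (i, c)"
  proof (cases c)
    case 0
    consider "i = 0" | "i = Suc 0" | i' where "i = Suc (Suc i')" by (metis not0_implies_Suc)
    then show ?thesis unfolding swap
      by cases (use ic 0 in \<open>simp_all add: H_lam_new_block H_lam_grow_block[where a = a]\<close>)
  next
    case (Suc c')
    consider "i = 0" | "i = Suc 0" | i' where "i = Suc (Suc i')" by (metis not0_implies_Suc)
    then show ?thesis unfolding swap
      by cases (use ic Suc in \<open>simp_all add: H_lam_new_block H_lam_grow_block[where a = a]\<close>)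
  qed
qed (simp_all add: swap_rows_cols_def)

section \<open>Determinants\<close>

lemma sum_atMost_add:
  fixes f :: "nat \<Rightarrow> 'a::comm_monoid_add"
  shows "(\<Sum>c\<le>a + s. f c) = (\<Sum>c<a. f c) + (\<Sum>d\<le>s. f (a + d))"
proof (induction s)
  case 0
  show ?case by (simp add: lessThan_Suc_atMost[symmetric])
next
  case (Suc s)
  then show ?case by (simp add: add.assoc)
qed

text \<open>The vector with last entry 1 that all rows of \<open>H_lam lam\<close> but row 0
  annihilate. A row of the first block meets it in one identity entry and along row 0 of the smaller
  matrix, which forces a constant value on the block.\<close>

fun kvec :: "nat list \<Rightarrow> nat \<Rightarrow> real" where
  "kvec [] c = 1"
| "kvec (a # lam) c =
     (if c < a then - (\<Sum>d\<le>sum_list lam. H_lam lam $$ (0, d) * kvec lam d) else kvec lam (c - a))"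

lemma kvec_last [simp]: "kvec lam (sum_list lam) = 1"
  by (induction lam) auto

lemma kvec_orth:
  "0 < i \<Longrightarrow> i \<le> sum_list lam \<Longrightarrow> (\<Sum>c\<le>sum_list lam. H_lam lam $$ (i, c) * kvec lam c) = 0"
proof (induction lam arbitrary: i)
  case (Cons a lam)
  let ?p = "\<Sum>d\<le>sum_list lam. H_lam lam $$ (0, d) * kvec lam d"
  have "(\<Sum>c\<le>sum_list (a # lam). H_lam (a # lam) $$ (i, c) * kvec (a # lam) c) =
      (\<Sum>c<a. (if i = Suc c then 1 else 0) * - ?p)
      + (\<Sum>d\<le>sum_list lam. H_lam lam $$ (i - a, d) * kvec lam d)"
    using Cons.prems by (simp add: sum_atMost_add H_lam_Cons)
  also have "\<dots> = 0"
  proof (cases "i \<le> a")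
    case True
    then obtain m where m: "i = Suc m" "m < a" using Cons.prems by (cases i) auto
    have "(\<Sum>c<a. (if i = Suc c then 1 else 0) * - ?p) = (\<Sum>c<a. if c = m then - ?p else 0)"
      using m by (intro sum.cong) auto
    also have "\<dots> = - ?p" using m by simp
    finally show ?thesis using True by simp
  next
    case False
    have "(\<Sum>c<a. (if i = Suc c then 1 else 0) * - ?p) = 0"
      using False by (intro sum.neutral) auto
    moreover have "(\<Sum>d\<le>sum_list lam. H_lam lam $$ (i - a, d) * kvec lam d) = 0"
      using False Cons.prems by (intro Cons.IH) auto
    ultimately show ?thesis by simp
  qed
  finally show ?case .
qed simp

lemma cont_frac_Cons: "cont_frac (a # lam) = real a + 1 / cont_frac lam"
  by (cases lam) auto

text \<open>Pairing \<open>kvec\<close> with row 0 and with its complement yields, up to sign, numerator and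
  denominator of the continued fraction. For the empty list the fraction is \<open>1 / 0\<close>, which agrees
  with \<open>cont_frac [] = 0\<close> and makes the recursion uniform.\<close>

lemma kvec_continuants:
  assumes "\<forall>x\<in>set lam. 0 < x"
  shows "\<exists>f g :: nat. coprime f g \<and> 0 < f \<and> real f / real g = cont_frac lam \<and>
    (\<Sum>c\<le>sum_list lam. H_lam lam $$ (0, c) * kvec lam c) = (-1) ^ length lam * real f \<and>
    (\<Sum>c\<le>sum_list lam. (1 - H_lam lam $$ (0, c)) * kvec lam c) = - ((-1) ^ length lam * real g)"
  using assms
proof (induction lam)
  case Nil
  show ?case by (rule exI[of _ 1], rule exI[of _ 0]) (simp add: H_lam_Nil)
next
  case (Cons a lam)
  let ?p = "\<Sum>d\<le>sum_list lam. H_lam lam $$ (0, d) * kvec lam d"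
  let ?q = "\<Sum>d\<le>sum_list lam. (1 - H_lam lam $$ (0, d)) * kvec lam d"
  obtain f g :: nat where fg: "coprime f g" "0 < f" "real f / real g = cont_frac lam"
    "?p = (-1) ^ length lam * real f" "?q = - ((-1) ^ length lam * real g)"
    using Cons by auto
  \<comment> \<open>The new row 0 is all ones on the first block and the complement of the old row 0
    after it, so the pair (f, g) becomes (a f + g, f): one step of the continued fraction.\<close>
  have p: "(\<Sum>c\<le>sum_list (a # lam). H_lam (a # lam) $$ (0, c) * kvec (a # lam) c) = - real a * ?p + ?q"
    by (simp add: sum_atMost_add H_lam_Cons)
  have q: "(\<Sum>c\<le>sum_list (a # lam). (1 - H_lam (a # lam) $$ (0, c)) * kvec (a # lam) c) = ?p"
    by (simp add: sum_atMost_add H_lam_Cons)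
  show ?case
  proof (rule exI[of _ "a * f + g"], rule exI[of _ f], intro conjI)
    show "coprime (a * f + g) f"
      using fg(1) by (metis add.commute coprime_commute coprime_iff_gcd_eq_1 gcd_add_mult mult.commute)
    show "0 < a * f + g" using fg Cons.prems by simp
    show "real (a * f + g) / real f = cont_frac (a # lam)"
      using fg(2) by (simp add: cont_frac_Cons fg(3)[symmetric] field_simps)
  qed (unfold p q fg(4,5), simp_all add: algebra_simps)
qed

lemma abs_det_H_lam:
  "\<bar>det (H_lam lam)\<bar> = \<bar>\<Sum>c\<le>sum_list lam. H_lam lam $$ (0, c) * kvec lam c\<bar>"
proof -
  define s where "s = sum_list lam"
  define p where "p = (\<Sum>c\<le>s. H_lam lam $$ (0, c) * kvec lam c)"
  \<comment> \<open>The identity with \<open>kvec lam\<close> as last column; because that vector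
    ends in 1, the determinant of \<open>X\<close> is 1.\<close>
  define X where "X = mat (Suc s) (Suc s)
    (\<lambda>(i, j). if j = s then kvec lam i else if i = j then 1 else (0::real))"
  define M where "M = H_lam lam * X"
  have H: "H_lam lam \<in> carrier_mat (Suc s) (Suc s)" by (simp add: H_lam_carrier s_def)
  have X: "X \<in> carrier_mat (Suc s) (Suc s)" by (simp add: X_def)
  have M: "M \<in> carrier_mat (Suc s) (Suc s)" using H X by (simp add: M_def)
  have "det X = prod_list (diag_mat X)"
    by (rule det_upper_triangular[OF _ X]) (auto simp: X_def upper_triangular_def)
  also have "diag_mat X = replicate (Suc s) 1"
    using kvec_last[of lam] by (intro nth_equalityI) (auto simp: diag_mat_def X_def s_def simp del: replicate_Suc upt_Suc)
  finally have "det X = 1" by simp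
  then have det: "det (H_lam lam) = det M" using det_mult[OF H X] by (simp add: M_def)
  have Mij: "M $$ (i, j) = (\<Sum>c\<le>s. H_lam lam $$ (i, c) * X $$ (c, j))"
    if "i \<le> s" "j \<le> s" for i j
    using that X by (auto simp: M_def scalar_prod_def s_def atLeast0LessThan lessThan_Suc_atMost intro!: sum.cong)
  have Mlast: "M $$ (i, s) = (if i = 0 then p else 0)" if "i \<le> s" for i
    using that kvec_orth[of i lam] by (simp add: Mij X_def p_def s_def)
  have Mother: "M $$ (i, j) = H_lam lam $$ (i, j)" if "i \<le> s" "j < s" for i j
  proof -
    have "M $$ (i, j) = (\<Sum>c\<le>s. if c = j then H_lam lam $$ (i, j) else 0)"
      unfolding Mij[OF that(1) less_imp_le[OF that(2)]]
      using that by (intro sum.cong refl) (simp add: X_def)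
    then show ?thesis using that by simp
  qed
  have "det M = (\<Sum>i<Suc s. M $$ (i, s) * cofactor M i s)"
    by (rule laplace_expansion_column[OF M]) simp
  also have "\<dots> = (\<Sum>i<Suc s. if i = 0 then p * cofactor M 0 s else 0)"
    by (intro sum.cong) (auto simp: Mlast)
  finally have "det M = p * cofactor M 0 s" by simp
  \<comment> \<open>Without row 0 and the last column, the subdiagonal of \<open>H_lam lam\<close>
    becomes the main diagonal, and the Hessenberg zeros make the minor triangular.\<close>
  moreover have "det (mat_delete M 0 s) = 1"
  proof -
    have D: "mat_delete M 0 s \<in> carrier_mat s s"
      using M by (intro carrier_matI) (auto simp: mat_delete_def)
    have ent: "mat_delete M 0 s $$ (i, j) = H_lam lam $$ (Suc i, j)" if "i < s" "j < s" for i j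
      using that M by (simp add: mat_delete_def Mother)
    have "det (mat_delete M 0 s) = prod_list (diag_mat (mat_delete M 0 s))"
      by (rule det_upper_triangular[OF _ D])
        (use D ent in \<open>auto simp: upper_triangular_def s_def H_lam_low\<close>)
    also have "diag_mat (mat_delete M 0 s) = replicate s 1"
      using D M ent by (intro nth_equalityI) (auto simp: diag_mat_def s_def H_lam_subdiag)
    finally show ?thesis by simp
  qed
  ultimately show ?thesis
    by (simp add: det cofactor_def abs_mult power_abs p_def s_def)
qed

section \<open>Inverses of ultrametric arrays\<close>

text \<open>\<open>x\<close> is a left inverse of \<open>a\<close> on \<open>S\<close> and a
  symmetric, strictly diagonally dominant M-matrix. Weak signs off the diagonal keep direct sums in
  the class; arrays over index sets avoid renumbering when \<open>S\<close> is split.\<close>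

definition dominant_inverse ::
    "(nat \<Rightarrow> nat \<Rightarrow> real) \<Rightarrow> (nat \<Rightarrow> nat \<Rightarrow> real) \<Rightarrow> nat set \<Rightarrow> bool" where
  "dominant_inverse x a S \<longleftrightarrow>
     (\<forall>i\<in>S. \<forall>j\<in>S. (\<Sum>k\<in>S. x i k * a k j) = (if i = j then 1 else 0)) \<and>
     (\<forall>i\<in>S. \<forall>j\<in>S. x i j = x j i) \<and>
     (\<forall>i\<in>S. \<forall>j\<in>S. i \<noteq> j \<longrightarrow> x i j \<le> 0) \<and>
     (\<forall>i\<in>S. 0 < (\<Sum>j\<in>S. x i j))"

text \<open>\<open>y\<close> is given by the Sherman--Morrison formula.\<close>

lemma dominant_inverse_add_const:
  assumes "finite S" and x: "dominant_inverse x a S" and "0 \<le> c"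
  defines "u \<equiv> \<lambda>i. \<Sum>k\<in>S. x i k"
  defines "y \<equiv> \<lambda>i j. x i j - c / (1 + c * (\<Sum>k\<in>S. u k)) * (u i * u j)"
  shows "dominant_inverse y (\<lambda>i j. a i j + c) S"
    and "\<And>i j. \<lbrakk>i \<in> S; j \<in> S; i \<noteq> j; 0 < c\<rbrakk> \<Longrightarrow> y i j < 0"
proof -
  define s where "s = (\<Sum>k\<in>S. u k)"
  have upos: "0 < u i" if "i \<in> S" for i using x that by (auto simp: dominant_inverse_def u_def)
  then have s: "0 \<le> s" unfolding s_def by (intro sum_nonneg) (simp add: less_imp_le)
  then have d: "0 < 1 + c * s" using \<open>0 \<le> c\<close> by (simp add: add_pos_nonneg)
  have y: "y i j = x i j - c / (1 + c * s) * (u i * u j)" for i j by (simp add: y_def s_def)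
  have inv: "(\<Sum>k\<in>S. x i k * a k j) = (if i = j then 1 else 0)" if "i \<in> S" "j \<in> S" for i j
    using x that by (auto simp: dominant_inverse_def)
  \<comment> \<open>By symmetry of \<open>x\<close> its row sums \<open>u\<close> are also its
    column sums, so adding up the rows of the product of \<open>x\<close> and \<open>a\<close> gives
    the all-ones vector.\<close>
  have ua: "(\<Sum>k\<in>S. u k * a k j) = 1" if "j \<in> S" for j
  proof -
    have "(\<Sum>k\<in>S. u k * a k j) = (\<Sum>k\<in>S. \<Sum>l\<in>S. x l k * a k j)"
      unfolding u_def sum_distrib_right
      using x by (intro sum.cong) (auto simp: dominant_inverse_def)
    also have "\<dots> = (\<Sum>l\<in>S. \<Sum>k\<in>S. x l k * a k j)" by (rule sum.swap)
    also have "\<dots> = (\<Sum>l\<in>S. if l = j then 1 else 0)" using that by (intro sum.cong) (auto simp: inv)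
    finally show ?thesis using that \<open>finite S\<close> by simp
  qed
  have eq: "(\<Sum>k\<in>S. y i k * (a k j + c)) = (if i = j then 1 else 0)" if "i \<in> S" "j \<in> S" for i j
  proof -
    have "(\<Sum>k\<in>S. y i k * (a k j + c)) = (\<Sum>k\<in>S. x i k * a k j) + c * (\<Sum>k\<in>S. x i k)
        - c / (1 + c * s) * u i * ((\<Sum>k\<in>S. u k * a k j) + c * (\<Sum>k\<in>S. u k))"
      unfolding y sum_distrib_left sum.distrib[symmetric] sum_subtractf[symmetric]
      by (intro sum.cong refl) (simp add: algebra_simps add_divide_distrib)
    also have "\<dots> = (if i = j then 1 else 0) + c * u i - c / (1 + c * s) * u i * (1 + c * s)"
      using that by (simp only: inv ua s_def[symmetric]) (simp add: u_def)
    finally show ?thesis using d by simp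
  qed
  have row: "0 < (\<Sum>j\<in>S. y i j)" if "i \<in> S" for i
  proof -
    have "(\<Sum>j\<in>S. y i j) = u i - c / (1 + c * s) * u i * s"
      unfolding y by (simp add: sum_subtractf s_def sum_distrib_left mult.assoc) (simp add: u_def)
    also have "\<dots> = u i / (1 + c * s)" using d by (simp add: field_simps)
    finally show ?thesis using upos[OF that] d by simp
  qed
  have le: "y i j \<le> x i j" if "i \<in> S" "j \<in> S" for i j
    unfolding y using upos[OF that(1)] upos[OF that(2)] d \<open>0 \<le> c\<close> by simp
  show "dominant_inverse y (\<lambda>i j. a i j + c) S"
    unfolding dominant_inverse_def
  proof (intro conjI ballI impI)
    fix i j assume "i \<in> S" "j \<in> S"
    then show "y i j = y j i" using x unfolding y by (simp add: dominant_inverse_def mult.commute)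
  next
    fix i j assume "i \<in> S" "j \<in> S" "i \<noteq> j"
    then show "y i j \<le> 0" using le[of i j] x by (force simp: dominant_inverse_def)
  qed (use eq row in auto)
  fix i j assume ij: "i \<in> S" "j \<in> S" "i \<noteq> j" "0 < c"
  then have "0 < c / (1 + c * s) * (u i * u j)" using upos d by simp
  moreover have "x i j \<le> 0" using x ij by (auto simp: dominant_inverse_def)
  ultimately show "y i j < 0" unfolding y by linarith
qed

lemma dominant_inverse_Un:
  assumes fin: "finite S" "finite T" and disj: "S \<inter> T = {}"
    and x: "dominant_inverse x a S" and y: "dominant_inverse y a T"
    and zero: "\<And>i j. i \<in> S \<Longrightarrow> j \<in> T \<Longrightarrow> a i j = 0 \<and> a j i = 0"
  shows "dominant_inverse
    (\<lambda>i j. if i \<in> S \<and> j \<in> S then x i j else if i \<in> T \<and> j \<in> T then y i j else 0) a (S \<union> T)"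
    (is "dominant_inverse ?z a _")
proof -
  have sum: "(\<Sum>k\<in>S \<union> T. g k) = (\<Sum>k\<in>S. g k) + (\<Sum>k\<in>T. g k)" for g :: "nat \<Rightarrow> real"
    by (rule sum.union_disjoint[OF fin disj])
  have zS: "(\<Sum>k\<in>S \<union> T. ?z i k * g k) = (\<Sum>k\<in>S. x i k * g k)" if "i \<in> S" for i and g :: "nat \<Rightarrow> real"
  proof -
    have "(\<Sum>k\<in>T. ?z i k * g k) = 0" using that disj by (intro sum.neutral) auto
    moreover have "(\<Sum>k\<in>S. ?z i k * g k) = (\<Sum>k\<in>S. x i k * g k)" using that by (intro sum.cong) auto
    ultimately show ?thesis by (simp add: sum)
  qed
  have zT: "(\<Sum>k\<in>S \<union> T. ?z i k * g k) = (\<Sum>k\<in>T. y i k * g k)" if "i \<in> T" for i and g :: "nat \<Rightarrow> real"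
  proof -
    have "i \<notin> S" using that disj by auto
    have "(\<Sum>k\<in>S. ?z i k * g k) = 0" using that disj by (intro sum.neutral) auto
    moreover have "(\<Sum>k\<in>T. ?z i k * g k) = (\<Sum>k\<in>T. y i k * g k)"
      using that \<open>i \<notin> S\<close> by (intro sum.cong) auto
    ultimately show ?thesis by (simp add: sum)
  qed
  have eq: "(\<Sum>k\<in>S \<union> T. ?z i k * a k j) = (if i = j then 1 else 0)"
    if ij: "i \<in> S \<union> T" "j \<in> S \<union> T" for i j
  proof (cases "i \<in> S")
    case True
    show ?thesis
    proof (cases "j \<in> S")
      case False
      then have "(\<Sum>k\<in>S. x i k * a k j) = 0" using ij zero by (intro sum.neutral) auto
      moreover have "i \<noteq> j" using True False by auto
      ultimately show ?thesis by (simp only: zS[OF True] if_False)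
    qed (use True x in \<open>unfold zS[OF True] dominant_inverse_def, blast\<close>)
  next
    case False
    then have i: "i \<in> T" using ij by auto
    show ?thesis
    proof (cases "j \<in> T")
      case False
      then have "(\<Sum>k\<in>T. y i k * a k j) = 0" using ij zero by (intro sum.neutral) auto
      moreover have "i \<noteq> j" using i False by auto
      ultimately show ?thesis by (simp only: zT[OF i] if_False)
    qed (use i y in \<open>unfold zT[OF i] dominant_inverse_def, blast\<close>)
  qed
  have row: "0 < (\<Sum>k\<in>S \<union> T. ?z i k)" if "i \<in> S \<union> T" for i
    using that zS[of i "\<lambda>_. 1"] zT[of i "\<lambda>_. 1"] x y by (auto simp: dominant_inverse_def)
  show ?thesis
    unfolding dominant_inverse_def
    by (intro conjI ballI impI eq row) (use x y in \<open>auto simp: dominant_inverse_def\<close>)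
qed

lemma ultrametric_dominant_inverse:
  assumes "finite S"
    and "\<And>i j. \<lbrakk>i \<in> S; j \<in> S\<rbrakk> \<Longrightarrow> a i j = a j i"
    and "\<And>i j. \<lbrakk>i \<in> S; j \<in> S\<rbrakk> \<Longrightarrow> 0 \<le> a i j"
    and "\<And>i. i \<in> S \<Longrightarrow> 0 < a i i"
    and "\<And>i j. \<lbrakk>i \<in> S; j \<in> S; i \<noteq> j\<rbrakk> \<Longrightarrow> a i j < a i i"
    and "\<And>i j k. \<lbrakk>i \<in> S; j \<in> S; k \<in> S\<rbrakk> \<Longrightarrow> min (a i k) (a k j) \<le> a i j"
  shows "\<exists>x. dominant_inverse x a S"
  using assms
proof (induction S arbitrary: a rule: finite_psubset_induct)
  case (psubset S)
  note sym = psubset.prems(1) and nonneg = psubset.prems(2) and diag = psubset.prems(3)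
    and dom = psubset.prems(4) and ultra = psubset.prems(5)
  consider "S = {}" | i where "S = {i}" | i j where "i \<in> S" "j \<in> S" "i \<noteq> j" by blast
  then show ?case
  proof cases
    case 1
    then show ?thesis by (simp add: dominant_inverse_def)
  next
    case (2 i)
    then show ?thesis using diag[of i]
      by (intro exI[of _ "\<lambda>_ _. 1 / a i i"]) (simp add: dominant_inverse_def)
  next
    case 3
    define D where "D = {(i, j). i \<in> S \<and> j \<in> S \<and> i \<noteq> j}"
    have "D \<subseteq> S \<times> S" by (auto simp: D_def)
    then have "finite D" using \<open>finite S\<close> finite_subset by blast
    moreover have "D \<noteq> {}" using 3 by (auto simp: D_def)
    ultimately obtain w where w: "w \<in> D" "\<And>v. v \<in> D \<Longrightarrow> case_prod a w \<le> case_prod a v"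
      using ex_min_if_finite[of "case_prod a ` D"] by (force simp: not_less)
    obtain p q where pq: "w = (p, q)" by fastforce
    define m where "m = a p q"
    have p: "p \<in> S" "q \<in> S" "p \<noteq> q" using w(1) by (auto simp: D_def pq)
    have min: "m \<le> a i j" if "i \<in> S" "j \<in> S" for i j
    proof (cases "i = j")
      case True
      then show ?thesis
        using that p w(2)[of "(i, p)"] w(2)[of "(i, q)"] dom[of i p] dom[of i q]
        by (cases "i = p") (auto simp: D_def pq m_def)
    next
      case False
      then show ?thesis using w(2)[of "(i, j)"] that by (auto simp: D_def pq m_def)
    qed
    \<comment> \<open>The indices whose entry with \<open>p\<close> exceeds the minimum
      \<open>m\<close>. The set contains \<open>p\<close> but not \<open>q\<close>, so it and its
      complement are both proper subsets.\<close>
    define T where "T = insert p {k \<in> S. m < a p k}"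
    have T: "T \<subset> S" "S - T \<subset> S" using p by (auto simp: T_def m_def)
    \<comment> \<open>Outside \<open>T\<close> the entry with \<open>p\<close> is exactly
      \<open>m\<close>. As \<open>a p i\<close> exceeds \<open>m\<close> for the other
      \<open>i\<close> in \<open>T\<close>, the ultrametric inequality through \<open>i\<close>
      keeps \<open>a i j\<close> down to \<open>m\<close>.\<close>
    have cross: "a i j = m \<and> a j i = m" if "i \<in> T" "j \<in> S - T" for i j
    proof -
      have S: "i \<in> S" "j \<in> S" using that T by auto
      have pj: "a p j = m" using that min[of p j] p by (auto simp: T_def)
      have "a i j \<le> m"
      proof (cases "i = p")
        case False
        then have "m < a p i" using that by (auto simp: T_def)
        then show ?thesis using ultra[of p j i] p S pj by (auto simp: min_def split: if_splits)
      qed (use pj in simp)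
      then show ?thesis using min[OF S] sym[OF S] by simp
    qed
    have ex: "\<exists>x. dominant_inverse x (\<lambda>i j. a i j - m) U" if "U \<subset> S" for U
    proof (rule psubset.IH[OF that])
      fix i assume i: "i \<in> U"
      then have "i \<in> S" using that by auto
      moreover obtain k where "k \<in> S" "k \<noteq> i" using p by metis
      ultimately show "0 < a i i - m" using dom[of i k] min[of i k] by simp
    next
      fix i j k assume "i \<in> U" "j \<in> U" "k \<in> U"
      then show "min (a i k - m) (a k j - m) \<le> a i j - m"
        using ultra[of i j k] psubsetD[OF that] by (auto simp: min_def split: if_splits)
    qed (use sym min dom psubsetD[OF that] in simp_all)
    obtain x y where xy: "dominant_inverse x (\<lambda>i j. a i j - m) T"
      "dominant_inverse y (\<lambda>i j. a i j - m) (S - T)"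
      using ex T by meson
    have fin: "finite T" "finite (S - T)" using T \<open>finite S\<close> by (auto intro: finite_subset)
    have TS: "T \<union> (S - T) = S" using T by auto
    obtain z where z: "dominant_inverse z (\<lambda>i j. a i j - m) S"
      using dominant_inverse_Un[OF fin _ xy] cross unfolding TS by auto
    have "0 \<le> m" using nonneg p by (simp add: m_def)
    from dominant_inverse_add_const(1)[OF \<open>finite S\<close> z this] show ?thesis by auto
  qed
qed

section \<open>The Gramian\<close>

definition gram_entry :: "nat list \<Rightarrow> nat \<Rightarrow> nat \<Rightarrow> real" where
  "gram_entry lam c d = (\<Sum>i\<le>sum_list lam. H_lam lam $$ (i, c) * H_lam lam $$ (i, d))"

lemma gram_H_lam:
  assumes "c \<le> sum_list lam" "d \<le> sum_list lam"
  shows "gram (H_lam lam) $$ (c, d) = gram_entry lam c d"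
  using assms
  by (auto simp: gram_def gram_entry_def scalar_prod_def atLeast0LessThan lessThan_Suc_atMost
      intro!: sum.cong)

lemma gram_entry_sym: "gram_entry lam c d = gram_entry lam d c"
  by (simp add: gram_entry_def mult.commute)

lemma gram_entry_Nil: "gram_entry [] 0 0 = 1"
  by (simp add: gram_entry_def H_lam_Nil)

text \<open>Row 0 of the smaller matrix occurs \<open>a\<close> times, as the continuation of each
  block row, and its complement once, on top. So a common 1 in it gains \<open>a - 1\<close> and a
  common 0 gains 1. A first-block column has two ones, and any other column hits exactly one of
  them.\<close>

lemma gram_entry_Cons:
  assumes c: "c \<le> a + sum_list lam" and d: "d \<le> a + sum_list lam"
  shows "gram_entry (a # lam) c d =
    (if c < a \<or> d < a then (if c = d then 2 else 1)
     else gram_entry lam (c - a) (d - a) +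
       (if H_lam lam $$ (0, c - a) \<noteq> H_lam lam $$ (0, d - a) then 0
        else if H_lam lam $$ (0, c - a) = 0 then 1 else real a - 1))"
proof -
  have split: "(\<Sum>i\<le>a + s. f i) = f 0 + (\<Sum>i<a. f (Suc i)) + (\<Sum>i<s. f (Suc (a + i)))"
    for f :: "nat \<Rightarrow> real" and s
  proof -
    have "(\<Sum>i\<le>a + s. f i) = f 0 + (\<Sum>i<a + s. f (Suc i))"
      by (rule sum.atMost_shift)
    also have "(\<Sum>i<a + s. f (Suc i)) = (\<Sum>i<a. f (Suc i)) + (\<Sum>i<s. f (Suc (a + i)))"
      by (induction s) (simp_all add: add.assoc)
    finally show ?thesis by simp
  qed
  have split0: "gram_entry lam u v = H_lam lam $$ (0, u) * H_lam lam $$ (0, v)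
      + (\<Sum>i<sum_list lam. H_lam lam $$ (Suc i, u) * H_lam lam $$ (Suc i, v))" for u v
    unfolding gram_entry_def by (rule sum.atMost_shift)
  have single: "(\<Sum>i<a. (if i = x then 1 else 0) * f i) = (if x < a then f x else 0)"
    for x and f :: "nat \<Rightarrow> real"
  proof -
    have "(\<Sum>i<a. (if i = x then 1 else 0) * f i) = (\<Sum>i<a. if i = x then f i else 0)"
      by (intro sum.cong) auto
    then show ?thesis by simp
  qed
  define R where "R x = (if x < a then 1 else 1 - H_lam lam $$ (0, x - a))" for x
  define U where "U i x = (if x < a then (if i = x then 1 else 0) else H_lam lam $$ (0, x - a))" for i x
  define L where "L i x = (if x < a then 0 else H_lam lam $$ (Suc i, x - a))" for i x
  have rows: "H_lam (a # lam) $$ (0, x) = R x"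
    "i < a \<Longrightarrow> H_lam (a # lam) $$ (Suc i, x) = U i x"
    "j < sum_list lam \<Longrightarrow> H_lam (a # lam) $$ (Suc (a + j), x) = L j x"
    if "x \<le> a + sum_list lam" for i j x
    using that by (auto simp: H_lam_Cons R_def U_def L_def)
  have main: "gram_entry (a # lam) c d =
      R c * R d + (\<Sum>i<a. U i c * U i d) + (\<Sum>j<sum_list lam. L j c * L j d)"
    using c d by (simp add: gram_entry_def split rows)
  have "H_lam lam $$ (0, x - a) = 0 \<or> H_lam lam $$ (0, x - a) = 1" if "x \<le> a + sum_list lam" for x
    using that by (intro H_lam_01) auto
  note 01 = this[OF c] this[OF d]
  have US: "(\<Sum>i<a. U i c * U i d) =
    (if c < a then U c d else if d < a then U d c else real a * (U 0 c * U 0 d))"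
    using single[of c "\<lambda>i. U i d"] single[of d "\<lambda>i. U i c"]
    by (auto simp: U_def mult.commute)
  have LS: "(\<Sum>j<sum_list lam. L j c * L j d) =
    (if c < a \<or> d < a then 0 else gram_entry lam (c - a) (d - a)
      - H_lam lam $$ (0, c - a) * H_lam lam $$ (0, d - a))"
    by (auto simp: L_def split0)
  show ?thesis
    unfolding main US LS using 01 by (auto simp: R_def U_def)
qed

text \<open>Columns with different entries in row 0 have inner product 1, the minimal value; columns with
  equal entries there gain a common constant in the recursion. So all conditions are preserved.\<close>

lemma gram_entry_ultrametric:
  assumes "\<forall>x\<in>set lam. 0 < x"
  defines "s \<equiv> sum_list lam" and "g \<equiv> gram_entry lam"
  shows "(\<forall>c\<le>s. \<forall>d\<le>s. 1 \<le> g c d) \<and>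
    (\<forall>c\<le>s. \<forall>d\<le>s. H_lam lam $$ (0, c) \<noteq> H_lam lam $$ (0, d) \<longrightarrow> g c d = 1) \<and>
    (\<forall>c\<le>s. \<forall>d\<le>s. \<forall>e\<le>s. min (g c e) (g e d) \<le> g c d)"
  using assms(1) unfolding s_def g_def
proof (induction lam)
  case Nil
  then show ?case by (simp add: gram_entry_Nil)
next
  case (Cons a lam)
  let ?s = "sum_list (a # lam)" and ?g = "gram_entry (a # lam)" and ?r = "\<lambda>c. H_lam lam $$ (0, c - a)"
  have pos: "1 \<le> real a" using Cons.prems by auto
  have IH: "1 \<le> gram_entry lam c d"
    "H_lam lam $$ (0, c) \<noteq> H_lam lam $$ (0, d) \<Longrightarrow> gram_entry lam c d = 1"
    "e \<le> sum_list lam \<Longrightarrow> min (gram_entry lam c e) (gram_entry lam e d) \<le> gram_entry lam c d"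
    if "c \<le> sum_list lam" "d \<le> sum_list lam" for c d e
    using Cons.IH Cons.prems that by simp_all
  have one: "1 \<le> ?g c d" if "c \<le> ?s" "d \<le> ?s" for c d
  proof -
    have "1 \<le> gram_entry lam (c - a) (d - a)" using that by (intro IH(1)) auto
    then show ?thesis using that pos by (auto simp: gram_entry_Cons)
  qed
  have diff: "?g c d = 1" if "c \<le> ?s" "d \<le> ?s"
    "H_lam (a # lam) $$ (0, c) \<noteq> H_lam (a # lam) $$ (0, d)" for c d
    using that IH(2)[of "c - a" "d - a"] by (auto simp: gram_entry_Cons H_lam_Cons split: if_splits)
  have ultra: "min (?g c e) (?g e d) \<le> ?g c d"
    if le: "c \<le> ?s" "d \<le> ?s" "e \<le> ?s" for c d e
  proof (cases "?g c e = 1 \<or> ?g e d = 1 \<or> c = e \<or> e = d")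
    case True
    then show ?thesis using one[OF le(1,2)] by (auto simp: min_def)
  next
    case False
    then have ge: "a \<le> c" "a \<le> d" "a \<le> e" using le by (auto simp: gram_entry_Cons split: if_splits)
    then have le': "c - a \<le> sum_list lam" "d - a \<le> sum_list lam" "e - a \<le> sum_list lam"
      using le by auto
    \<comment> \<open>Between distinct columns, an entry other than 1 arises only beyond the first
      block and for equal top entries, so all three pairs gain the same constant.\<close>
    have r: "?r c = ?r e" "?r e = ?r d"
      using False ge le IH(2)[OF le'(1,3)] IH(2)[OF le'(3,2)]
      by (auto simp: gram_entry_Cons split: if_splits)
    show ?thesis
      using ge le IH(3)[OF le'(1,2,3)] by (simp add: gram_entry_Cons r min_def split: if_splits)
  qed
  show ?case using one diff ultra by blast
qed

text \<open>The last column carries no identity entry; for a single part \<open>a\<close> it has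
  exactly \<open>a\<close> ones, which is where the bound on the last part enters. Prepending a part
  never decreases a diagonal entry.\<close>

lemma gram_entry_diag:
  assumes "lam \<noteq> []" "\<forall>x\<in>set lam. 0 < x" "2 \<le> last lam" "c \<le> sum_list lam"
  shows "2 \<le> gram_entry lam c c"
  using assms
proof (induction lam arbitrary: c rule: list_nonempty_induct)
  case (single a)
  then show ?case by (auto simp: gram_entry_Cons gram_entry_Nil H_lam_Nil)
next
  case (cons a lam)
  show ?case
  proof (cases "c < a")
    case False
    then have "2 \<le> gram_entry lam (c - a) (c - a)" using cons by (intro cons.IH) auto
    then show ?thesis using False cons.prems by (auto simp: gram_entry_Cons)
  qed (use cons.prems in \<open>simp add: gram_entry_Cons\<close>)
qed

text \<open>Off-diagonal entries involving a first-block column equal 1, below the diagonal bound 2.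
  Elsewhere the diagonal entry gains at least as much in the recursion as the others in its
  row.\<close>

lemma gram_entry_dominant:
  assumes "lam \<noteq> []" "\<forall>x\<in>set lam. 0 < x" "2 \<le> last lam"
    and "c \<le> sum_list lam" "d \<le> sum_list lam" "c \<noteq> d"
  shows "gram_entry lam c d < gram_entry lam c c"
  using assms
proof (induction lam arbitrary: c d rule: list_nonempty_induct)
  case (single a)
  then show ?case
    using gram_entry_diag[of "[a]" c] by (auto simp: gram_entry_Cons split: if_splits)
next
  case (cons a lam)
  have diag: "2 \<le> gram_entry (a # lam) c c" using cons by (intro gram_entry_diag) auto
  show ?case
  proof (cases "c < a \<or> d < a")
    case True
    then have "gram_entry (a # lam) c d = 1" using cons.prems by (auto simp: gram_entry_Cons)
    then show ?thesis using diag by simp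
  next
    case False
    then have "gram_entry lam (c - a) (d - a) < gram_entry lam (c - a) (c - a)"
      using cons.prems cons.hyps by (intro cons.IH) auto
    moreover have "1 \<le> real a" using cons.prems by auto
    ultimately show ?thesis using False cons.prems by (auto simp: gram_entry_Cons)
  qed
qed

section \<open>Strict ultrametricity of the Gramian, and acuteness\<close>

lemma good_compositionD:
  assumes "good_composition m lam"
  shows "lam \<noteq> []" "\<forall>x\<in>set lam. 0 < x" "2 \<le> last lam"
  using assms by (auto simp: good_composition_def)

lemma gram_carrier: "A \<in> carrier_mat n n \<Longrightarrow> gram A \<in> carrier_mat n n"
  by (simp add: gram_def)

text \<open>The ultrametric inequalities say that the smallest of the three off-diagonal entries
  occurs twice; the index shared by these two pairs is the \<open>r\<close> of the
  definition.\<close>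

lemma strictly_ultrametric_gram_H_lam:
  assumes "good_composition m lam"
  shows "strictly_ultrametric (gram (H_lam lam))"
proof -
  note D = good_compositionD[OF assms]
  let ?s = "sum_list lam"
  define g where "g = gram_entry lam"
  have carrier: "gram (H_lam lam) \<in> carrier_mat (Suc ?s) (Suc ?s)"
    by (intro gram_carrier H_lam_carrier)
  have G: "gram (H_lam lam) $$ (c, d) = g c d" if "c \<le> ?s" "d \<le> ?s" for c d
    using that by (simp add: gram_H_lam g_def)
  have sym: "g c d = g d c" for c d by (simp add: g_def gram_entry_sym)
  have dom: "g c d < g c c" if "c \<le> ?s" "d \<le> ?s" "c \<noteq> d" for c d
    using gram_entry_dominant[OF D(1-3) that] by (simp add: g_def)
  have ultra: "min (g c e) (g e d) \<le> g c d" if "c \<le> ?s" "d \<le> ?s" "e \<le> ?s" for c d e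
    using gram_entry_ultrametric[OF D(2)] that by (simp add: g_def)
  \<comment> \<open>Here \<open>k\<close> serves as \<open>r\<close>, and the other two indices are
    ordered by their diagonal entries.\<close>
  have order: "\<exists>p q. {p, q, k} = {i, j, k} \<and> g p k = g q k \<and> g p k \<le> g p q \<and> g p q < g q q \<and>
      g q q \<le> g p p \<and> g p k < g k k"
    if le: "i \<le> ?s" "j \<le> ?s" "k \<le> ?s" and neq: "i \<noteq> j" "j \<noteq> k" "i \<noteq> k"
      and eq: "g i k = g j k" "g i k \<le> g i j" for i j k
  proof (cases "g j j \<le> g i i")
    case True
    then show ?thesis
      using dom[of j i] dom[of k i] sym[of i j] sym[of i k] le neq eq
      by (intro exI[of _ i] exI[of _ j]) auto
  next
    case False
    then show ?thesis
      using dom[of i j] dom[of k j] sym[of i j] sym[of j k] le neq eq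
      by (intro exI[of _ j] exI[of _ i]) auto
  qed
  have triple: "\<exists>p q r. {p, q, r} = {i, j, k} \<and> g p r = g q r \<and> g p r \<le> g p q \<and> g p q < g q q \<and>
      g q q \<le> g p p \<and> g p r < g r r"
    if le: "i \<le> ?s" "j \<le> ?s" "k \<le> ?s" and neq: "i \<noteq> j" "j \<noteq> k" "i \<noteq> k" for i j k
  proof -
    have "min (g i k) (g k j) \<le> g i j" "min (g i j) (g j k) \<le> g i k" "min (g j i) (g i k) \<le> g j k"
      using ultra le by auto
    then consider "g i k = g j k" "g i k \<le> g i j" | "g i j = g k j" "g i j \<le> g i k"
      | "g j i = g k i" "g j i \<le> g j k"
      using sym[of i j] sym[of i k] sym[of j k] by (auto simp: min_def split: if_splits)
    then show ?thesis
    proof cases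
      case 1
      then show ?thesis using order[of i j k] le neq by blast
    next
      case 2
      then obtain p q where "{p, q, j} = {i, k, j} \<and> g p j = g q j \<and> g p j \<le> g p q \<and>
          g p q < g q q \<and> g q q \<le> g p p \<and> g p j < g j j"
        using order[of i k j] le neq by blast
      moreover have "{i, k, j} = {i, j, k}" by auto
      ultimately show ?thesis by metis
    next
      case 3
      then obtain p q where "{p, q, i} = {j, k, i} \<and> g p i = g q i \<and> g p i \<le> g p q \<and>
          g p q < g q q \<and> g q q \<le> g p p \<and> g p i < g i i"
        using order[of j k i] le neq by blast
      moreover have "{j, k, i} = {i, j, k}" by auto
      ultimately show ?thesis by metis
    qed
  qed
  show ?thesis
    unfolding strictly_ultrametric_def
  proof (intro conjI allI impI)
    show "square_mat (gram (H_lam lam))" using carrier by auto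
    show "transpose_mat (gram (H_lam lam)) = gram (H_lam lam)"
      using carrier by (intro eq_matI) (auto simp: G sym)
  next
    fix i j k
    assume "i < dim_row (gram (H_lam lam)) \<and> j < dim_row (gram (H_lam lam)) \<and>
      k < dim_row (gram (H_lam lam)) \<and> i \<noteq> j \<and> j \<noteq> k \<and> i \<noteq> k"
    then have le: "i \<le> ?s" "j \<le> ?s" "k \<le> ?s" and neq: "i \<noteq> j" "j \<noteq> k" "i \<noteq> k"
      using carrier by auto
    obtain p q r where pqr: "{p, q, r} = {i, j, k}" and
      g: "g p r = g q r" "g p r \<le> g p q" "g p q < g q q" "g q q \<le> g p p" "g p r < g r r"
      using triple[OF le neq] by blast
    have "p \<le> ?s" "q \<le> ?s" "r \<le> ?s"
    proof -
      have "x \<le> ?s" if "x \<in> {p, q, r}" for x using that le unfolding pqr by auto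
      then show "p \<le> ?s" "q \<le> ?s" "r \<le> ?s" by auto
    qed
    then show "\<exists>p q r. {p, q, r} = {i, j, k} \<and>
        gram (H_lam lam) $$ (p, r) = gram (H_lam lam) $$ (q, r) \<and>
        gram (H_lam lam) $$ (p, r) \<le> gram (H_lam lam) $$ (p, q) \<and>
        gram (H_lam lam) $$ (p, q) < gram (H_lam lam) $$ (q, q) \<and>
        gram (H_lam lam) $$ (q, q) \<le> gram (H_lam lam) $$ (p, p) \<and>
        gram (H_lam lam) $$ (p, r) < gram (H_lam lam) $$ (r, r)"
      using pqr g by (intro exI[of _ p] exI[of _ q] exI[of _ r]) (simp add: G)
  qed
qed

text \<open>The Gramian minus the all-ones array is nonnegative and ultrametric, but its inverse may
  have zeros off the diagonal. Adding the constant 1 back makes those entries strictly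
  negative.\<close>

lemma acute_simplex_H_lam:
  assumes "good_composition m lam"
  shows "acute_simplex (H_lam lam)"
proof -
  note D = good_compositionD[OF assms]
  define n where "n = Suc (sum_list lam)"
  define S where "S = {..<n}"
  define g where "g = gram_entry lam"
  have S: "i \<in> S \<longleftrightarrow> i \<le> sum_list lam" for i by (auto simp: S_def n_def)
  have "\<exists>x. dominant_inverse x (\<lambda>i j. g i j - 1) S"
  proof (rule ultrametric_dominant_inverse)
    fix i j k assume "i \<in> S" "j \<in> S" "k \<in> S"
    then show "min (g i k - 1) (g k j - 1) \<le> g i j - 1"
      using gram_entry_ultrametric[OF D(2)] by (fastforce simp: S g_def min_def split: if_splits)
  next
    fix i j assume "i \<in> S" "j \<in> S"
    then show "0 \<le> g i j - 1" using gram_entry_ultrametric[OF D(2)] by (simp add: S g_def)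
  next
    fix i assume "i \<in> S"
    then show "0 < g i i - 1" using gram_entry_diag[OF D(1-3), of i] by (simp add: S g_def)
  next
    fix i j assume "i \<in> S" "j \<in> S" "i \<noteq> j"
    then show "g i j - 1 < g i i - 1" using gram_entry_dominant[OF D(1-3)] by (simp add: S g_def)
  qed (auto simp: S_def g_def gram_entry_sym)
  then obtain x where x: "dominant_inverse x (\<lambda>i j. g i j - 1) S" by blast
  obtain y where y: "dominant_inverse y g S" "\<And>i j. \<lbrakk>i \<in> S; j \<in> S; i \<noteq> j\<rbrakk> \<Longrightarrow> y i j < 0"
    using dominant_inverse_add_const[OF _ x, of 1] by (auto simp: S_def)
  define Gi where "Gi = mat n n (\<lambda>(i, j). y i j)"
  have Gi: "Gi \<in> carrier_mat n n" by (simp add: Gi_def)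
  have G: "gram (H_lam lam) \<in> carrier_mat n n"
    unfolding n_def by (intro gram_carrier H_lam_carrier)
  have "Gi * gram (H_lam lam) = 1\<^sub>m n"
  proof (intro eq_matI)
    fix i j assume "i < dim_row (1\<^sub>m n :: real mat)" "j < dim_col (1\<^sub>m n :: real mat)"
    then have ij: "i \<in> S" "j \<in> S" by (auto simp: S_def)
    have "(Gi * gram (H_lam lam)) $$ (i, j) = (\<Sum>k\<in>S. y i k * g k j)"
      using ij G by (auto simp: Gi_def scalar_prod_def S_def n_def atLeast0LessThan gram_H_lam g_def
          intro!: sum.cong)
    also have "\<dots> = (if i = j then 1 else 0)"
      using y(1) ij unfolding dominant_inverse_def by blast
    finally show "(Gi * gram (H_lam lam)) $$ (i, j) = 1\<^sub>m n $$ (i, j)"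
      using ij by (simp add: S_def)
  qed (use Gi G in auto)
  moreover from mat_mult_left_right_inverse[OF Gi G this] have "gram (H_lam lam) * Gi = 1\<^sub>m n" .
  ultimately show ?thesis
    unfolding acute_simplex_def
    using Gi G y
    by (intro conjI exI[of _ Gi])
      (auto simp: inverts_mat_def n_def[symmetric] dominant_inverse_def Gi_def S_def)
qed

section \<open>Rows of acute 0/1-matrices\<close>

text \<open>\<open>W\<close> is the inverse Gramian times the transpose of \<open>H\<close>, and the signs follow from the diagonal
  dominance of the inverse Gramian.\<close>

lemma acute_inverse_signs:
  assumes H: "H \<in> carrier_mat n n" and zo: "zero_one_mat H" and ac: "acute_simplex H"
  shows "\<exists>W. (\<forall>i<n. \<forall>j<n. (\<Sum>k<n. H $$ (i, k) * W k j) = (if i = j then 1 else 0)) \<and>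
    (\<forall>j<n. \<forall>k<n. (H $$ (j, k) = 1 \<longrightarrow> 0 < W k j) \<and> (H $$ (j, k) = 0 \<longrightarrow> W k j < 0))"
proof -
  obtain Gi where Gi: "Gi \<in> carrier_mat n n" and inv: "Gi * gram H = 1\<^sub>m n"
    and off: "\<And>i j. \<lbrakk>i < n; j < n; i \<noteq> j\<rbrakk> \<Longrightarrow> Gi $$ (i, j) < 0"
    and row: "\<And>i. i < n \<Longrightarrow> 0 < (\<Sum>j<n. Gi $$ (i, j))"
    using ac H by (auto simp: acute_simplex_def inverts_mat_def)
  have zo': "H $$ (i, j) = 0 \<or> H $$ (i, j) = 1" if "i < n" "j < n" for i j
    using zo H that by (auto simp: zero_one_mat_def)
  \<comment> \<open>This is the inverse of \<open>H\<close>. Its entry at \<open>(k, j)\<close> adds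
    up row \<open>k\<close> of \<open>Gi\<close> over the ones of row \<open>j\<close> of
    \<open>H\<close>.\<close>
  define V where "V = Gi * transpose_mat H"
  have V: "V \<in> carrier_mat n n" using Gi H by (simp add: V_def)
  have "V * H = 1\<^sub>m n" using inv Gi H by (simp add: V_def gram_def assoc_mult_mat)
  from mat_mult_left_right_inverse[OF V H this] have HV: "H * V = 1\<^sub>m n" .
  have one: "(\<Sum>k<n. H $$ (i, k) * V $$ (k, j)) = (if i = j then 1 else 0)" if "i < n" "j < n" for i j
  proof -
    have "(\<Sum>k<n. H $$ (i, k) * V $$ (k, j)) = (H * V) $$ (i, j)"
      using that H V by (auto simp: scalar_prod_def atLeast0LessThan intro!: sum.cong)
    then show ?thesis using that by (simp add: HV)
  qed
  have Vij: "V $$ (k, j) = (\<Sum>l<n. Gi $$ (k, l) * H $$ (j, l))" if "k < n" "j < n" for k j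
    using that Gi H by (auto simp: V_def scalar_prod_def atLeast0LessThan intro!: sum.cong)
  have pos: "0 < V $$ (k, j)" if "j < n" "k < n" "H $$ (j, k) = 1" for j k
  proof -
    \<comment> \<open>The partial sum contains the diagonal entry of \<open>Gi\<close>, so only
      negative entries of the row are left out.\<close>
    have "Gi $$ (k, l) \<le> Gi $$ (k, l) * H $$ (j, l)" if "l < n" for l
      using zo'[of j l] off[of k l] \<open>j < n\<close> \<open>k < n\<close> \<open>H $$ (j, k) = 1\<close> that by (cases "k = l") auto
    then have "(\<Sum>l<n. Gi $$ (k, l)) \<le> V $$ (k, j)" using that by (auto simp: Vij intro: sum_mono)
    then show ?thesis using row[of k] that by simp
  qed
  have neg: "V $$ (k, j) < 0" if "j < n" "k < n" "H $$ (j, k) = 0" for j k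
  proof -
    have "\<exists>l<n. H $$ (j, l) \<noteq> 0"
    proof (rule ccontr)
      assume "\<not> ?thesis"
      then have "(\<Sum>k<n. H $$ (j, k) * V $$ (k, j)) = 0" by (intro sum.neutral) auto
      then show False using one[of j j] that by simp
    qed
    then obtain l where l: "l < n" "H $$ (j, l) = 1" using zo'[OF \<open>j < n\<close>] by blast
    have le: "Gi $$ (k, m) * H $$ (j, m) \<le> 0" if "m < n" for m
      using zo'[of j m] off[of k m] \<open>j < n\<close> \<open>k < n\<close> \<open>H $$ (j, k) = 0\<close> that by (cases "k = m") auto
    have "Gi $$ (k, l) * H $$ (j, l) < 0"
      using l that off[of k l] by (cases "k = l") auto
    then have "(\<Sum>m<n. Gi $$ (k, m) * H $$ (j, m)) < (\<Sum>m<n. 0)"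
      using l(1) by (intro sum_strict_mono_ex1 ballI bexI[of _ l] le) simp_all
    then show ?thesis using that by (simp add: Vij)
  qed
  show ?thesis using one pos neg by (intro exI[of _ "\<lambda>k j. V $$ (k, j)"]) blast
qed

text \<open>Row \<open>i\<close> of \<open>H\<close> pairs to zero with column \<open>j\<close> of
  the inverse. That column is positive on the ones of row \<open>j\<close> and negative elsewhere,
  so the ones of row \<open>i\<close>, a nonempty set, must lie in both places.\<close>

lemma acute_rows:
  assumes H: "H \<in> carrier_mat n n" and zo: "zero_one_mat H" and ac: "acute_simplex H"
    and ij: "i < n" "j < n" "i \<noteq> j"
  shows "\<exists>c<n. H $$ (i, c) = 1 \<and> H $$ (j, c) = 1" "\<exists>c<n. H $$ (i, c) = 1 \<and> H $$ (j, c) = 0"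
proof -
  obtain W where inv: "(\<Sum>k<n. H $$ (i, k) * W k j) = (if i = j then 1 else 0)"
    and pos: "H $$ (j, k) = 1 \<Longrightarrow> k < n \<Longrightarrow> 0 < W k j"
    and neg: "H $$ (j, k) = 0 \<Longrightarrow> k < n \<Longrightarrow> W k j < 0"
    if "i < n" "j < n" for i j k
    using acute_inverse_signs[OF H zo ac] by blast
  have zo': "H $$ (i, j) = 0 \<or> H $$ (i, j) = 1" if "i < n" "j < n" for i j
    using zo H that by (auto simp: zero_one_mat_def)
  have sum0: "(\<Sum>k<n. H $$ (i, k) * W k j) = 0" using inv[OF ij(1,2)] ij by simp
  have "\<exists>l<n. H $$ (i, l) \<noteq> 0"
  proof (rule ccontr)
    assume "\<not> ?thesis"
    then have "(\<Sum>k<n. H $$ (i, k) * W k i) = 0" by (intro sum.neutral) auto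
    then show False using inv[of i i] ij by simp
  qed
  then obtain l where l: "l < n" "H $$ (i, l) = 1" using zo'[OF ij(1)] by blast
  show "\<exists>c<n. H $$ (i, c) = 1 \<and> H $$ (j, c) = 1"
  proof (rule ccontr)
    assume "\<not> ?thesis"
    then have W: "W k j < 0" if "k < n" "H $$ (i, k) = 1" for k
      using that neg[of i j k] zo'[of j k] ij by auto
    have "H $$ (i, k) * W k j \<le> 0" if "k < n" for k using W[OF that] zo'[OF ij(1) that] by auto
    moreover have "H $$ (i, l) * W l j < 0" using W l by simp
    ultimately have "(\<Sum>k<n. H $$ (i, k) * W k j) < (\<Sum>k<n. 0)"
      using l(1) by (intro sum_strict_mono_ex1 ballI bexI[of _ l]) simp_all
    then show False using sum0 by simp
  qed
  show "\<exists>c<n. H $$ (i, c) = 1 \<and> H $$ (j, c) = 0"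
  proof (rule ccontr)
    assume "\<not> ?thesis"
    then have W: "0 < W k j" if "k < n" "H $$ (i, k) = 1" for k
      using that pos[of i j k] zo'[of j k] ij by auto
    have "0 \<le> H $$ (i, k) * W k j" if "k < n" for k using W[OF that] zo'[OF ij(1) that] by auto
    moreover have "0 < H $$ (i, l) * W l j" using W l by simp
    ultimately have "(\<Sum>k<n. 0) < (\<Sum>k<n. H $$ (i, k) * W k j)"
      using l(1) by (intro sum_strict_mono_ex1 ballI bexI[of _ l]) simp_all
    then show False using sum0 by simp
  qed
qed

section \<open>Classification\<close>

lemma all_le_Suc: "(\<forall>c\<le>Suc s. P c) \<longleftrightarrow> P 0 \<and> (\<forall>c\<le>s. P (Suc c))"
  by (metis Suc_le_mono le0 not0_implies_Suc)

text \<open>Acuteness enters only through conditions on pairs of rows. All the conditions survive an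
  exchange of the last two columns, so one argument serves both versions of the matrix.\<close>

locale crossing_hessenberg =
  fixes n :: nat and H :: "real mat"
  assumes carrier: "H \<in> carrier_mat n n"
    and zero_one: "\<lbrakk>i < n; j < n\<rbrakk> \<Longrightarrow> H $$ (i, j) = 0 \<or> H $$ (i, j) = 1"
    and low: "\<lbrakk>i < n; Suc j < i\<rbrakk> \<Longrightarrow> H $$ (i, j) = 0"
    and subdiag: "Suc j < n \<Longrightarrow> H $$ (Suc j, j) = 1"
    and meet: "\<lbrakk>i < n; j < n; i \<noteq> j\<rbrakk> \<Longrightarrow> \<exists>c<n. H $$ (i, c) = 1 \<and> H $$ (j, c) = 1"
    and differ: "\<lbrakk>i < n; j < n; i \<noteq> j\<rbrakk> \<Longrightarrow> \<exists>c<n. H $$ (i, c) = 1 \<and> H $$ (j, c) = 0"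
begin

text \<open>The invariant of the upward induction: from column \<open>m\<close> on, the rows below
  row \<open>m\<close> are settled, while row \<open>m\<close> and those above it are known only up
  to complement.\<close>

definition tail_shape :: "nat \<Rightarrow> nat list \<Rightarrow> bool" where
  "tail_shape m lam \<longleftrightarrow> Suc (m + sum_list lam) = n \<and>
     (\<forall>i c. 0 < i \<and> i \<le> sum_list lam \<and> c \<le> sum_list lam \<longrightarrow> H $$ (m + i, m + c) = H_lam lam $$ (i, c)) \<and>
     (\<forall>i\<le>m. (\<forall>c\<le>sum_list lam. H $$ (i, m + c) = H_lam lam $$ (0, c)) \<or>
            (\<forall>c\<le>sum_list lam. H $$ (i, m + c) = 1 - H_lam lam $$ (0, c)))"

text \<open>Row \<open>Suc m\<close> starts in column \<open>m\<close>. A row above it that agreed with it from there on would contain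
  it, and a row that is complementary to it from there on would be disjoint from it.\<close>

lemma upper_row_agree:
  assumes "Suc m < n" "i \<le> m" "\<And>c. \<lbrakk>m < c; c < n\<rbrakk> \<Longrightarrow> H $$ (i, c) = H $$ (Suc m, c)"
  shows "H $$ (i, m) = 0"
proof (rule ccontr)
  assume "H $$ (i, m) \<noteq> 0"
  then have one: "H $$ (i, m) = 1" using zero_one[of i m] assms by auto
  obtain c where "c < n" "H $$ (Suc m, c) = 1" "H $$ (i, c) = 0"
    using differ[of "Suc m" i] assms by auto
  then show False using low[of "Suc m" c] assms one by (cases c m rule: linorder_cases) auto
qed

lemma upper_row_opposite:
  assumes "Suc m < n" "i \<le> m" "\<And>c. \<lbrakk>m < c; c < n\<rbrakk> \<Longrightarrow> H $$ (i, c) = 1 - H $$ (Suc m, c)"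
  shows "H $$ (i, m) = 1"
proof (rule ccontr)
  assume "H $$ (i, m) \<noteq> 1"
  then have zero: "H $$ (i, m) = 0" using zero_one[of i m] assms by auto
  obtain c where "c < n" "H $$ (Suc m, c) = 1" "H $$ (i, c) = 1"
    using meet[of "Suc m" i] assms by auto
  then show False using low[of "Suc m" c] assms zero by (cases c m rule: linorder_cases) auto
qed

text \<open>Both ways to extend the composition make row \<open>Suc m\<close> row 1 and put its
  complement, preceded by 1, on top. An upper row agrees with row \<open>Suc m\<close> beyond column
  \<open>m\<close> or is complementary to it there, and its entry in column \<open>m\<close> is then
  forced to match.\<close>

lemma tail_shape_extend:
  assumes T: "tail_shape (Suc m) lam"
    and sum: "sum_list lam' = Suc (sum_list lam)"
    and first: "H_lam lam' $$ (0, 0) = 1"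
      "\<And>i. i \<le> sum_list lam \<Longrightarrow> H_lam lam' $$ (Suc i, 0) = (if i = 0 then 1 else 0)"
    and inner: "\<And>i c. \<lbrakk>0 < i; i \<le> sum_list lam; c \<le> sum_list lam\<rbrakk> \<Longrightarrow>
      H_lam lam' $$ (Suc i, Suc c) = H_lam lam $$ (i, c)"
    and row1: "\<And>c. c \<le> sum_list lam \<Longrightarrow> H_lam lam' $$ (Suc 0, Suc c) = H $$ (Suc m, Suc (m + c))"
    and row0: "\<And>c. c \<le> sum_list lam \<Longrightarrow> H_lam lam' $$ (0, Suc c) = 1 - H $$ (Suc m, Suc (m + c))"
  shows "tail_shape m lam'"
proof -
  let ?s = "sum_list lam"
  have n: "n = Suc (Suc (m + ?s))" using T by (simp add: tail_shape_def)
  have block: "H $$ (m + i, m + c) = H_lam lam' $$ (i, c)"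
    if le: "0 < i" "i \<le> Suc ?s" "c \<le> Suc ?s" for i c
  proof -
    obtain i' where i: "i = Suc i'" using le by (cases i) auto
    show ?thesis
    proof (cases c)
      case 0
      then show ?thesis using le i n low[of "Suc (m + i')" m] subdiag[of m] first(2)[of i'] by auto
    next
      case (Suc c')
      have "H $$ (Suc (m + i'), Suc (m + c')) = H_lam lam $$ (i', c')" if "0 < i'"
        using T that le i Suc by (simp add: tail_shape_def)
      then show ?thesis using le i Suc row1[of c'] inner[of i' c'] by (cases "i' = 0") auto
    qed
  qed
  have tails: "(\<forall>c\<le>?s. H $$ (i, Suc (m + c)) = H_lam lam $$ (0, c)) \<or>
      (\<forall>c\<le>?s. H $$ (i, Suc (m + c)) = 1 - H_lam lam $$ (0, c))" if "i \<le> Suc m" for i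
    using T that by (simp add: tail_shape_def)
  have upper: "(\<forall>c\<le>Suc ?s. H $$ (i, m + c) = H_lam lam' $$ (0, c)) \<or>
      (\<forall>c\<le>Suc ?s. H $$ (i, m + c) = 1 - H_lam lam' $$ (0, c))" if i: "i \<le> m" for i
  proof -
    have "(\<forall>c\<le>?s. H $$ (i, Suc (m + c)) = H $$ (Suc m, Suc (m + c))) \<or>
        (\<forall>c\<le>?s. H $$ (i, Suc (m + c)) = 1 - H $$ (Suc m, Suc (m + c)))"
      using tails[of i] tails[of "Suc m"] i by auto
    then show ?thesis
    proof
      assume w: "\<forall>c\<le>?s. H $$ (i, Suc (m + c)) = H $$ (Suc m, Suc (m + c))"
      have "H $$ (i, c) = H $$ (Suc m, c)" if "m < c" "c < n" for c
        using w[rule_format, of "c - Suc m"] that n by simp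
      then have "H $$ (i, m) = 0" using i n by (intro upper_row_agree) auto
      then have "\<forall>c\<le>Suc ?s. H $$ (i, m + c) = 1 - H_lam lam' $$ (0, c)"
        using w first(1) row0 by (simp add: all_le_Suc)
      then show ?thesis ..
    next
      assume w: "\<forall>c\<le>?s. H $$ (i, Suc (m + c)) = 1 - H $$ (Suc m, Suc (m + c))"
      have "H $$ (i, c) = 1 - H $$ (Suc m, c)" if "m < c" "c < n" for c
        using w[rule_format, of "c - Suc m"] that n by simp
      then have "H $$ (i, m) = 1" using i n by (intro upper_row_opposite) auto
      then have "\<forall>c\<le>Suc ?s. H $$ (i, m + c) = H_lam lam' $$ (0, c)"
        using w first(1) row0 by (simp add: all_le_Suc)
      then show ?thesis ..
    qed
  qed
  show ?thesis unfolding tail_shape_def sum using n block upper by simp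
qed

lemma tail_shape_new_block:
  assumes "tail_shape (Suc m) lam"
    and "\<And>c. c \<le> sum_list lam \<Longrightarrow> H $$ (Suc m, Suc (m + c)) = H_lam lam $$ (0, c)"
  shows "tail_shape m (Suc 0 # lam)"
  using assms by (intro tail_shape_extend[of m lam]) (simp_all add: H_lam_new_block)

lemma tail_shape_grow_block:
  assumes "tail_shape (Suc m) (a # lam)"
    and "\<And>c. c \<le> a + sum_list lam \<Longrightarrow> H $$ (Suc m, Suc (m + c)) = 1 - H_lam (a # lam) $$ (0, c)"
  shows "tail_shape m (Suc a # lam)"
  using assms by (intro tail_shape_extend[of m "a # lam"]) (simp_all add: H_lam_grow_block)

lemma tail_shape_step:
  assumes T: "tail_shape (Suc m) lam" and lam: "lam \<noteq> []" "\<forall>x\<in>set lam. 0 < x" "2 \<le> last lam"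
  shows "\<exists>lam'. tail_shape m lam' \<and> lam' \<noteq> [] \<and> (\<forall>x\<in>set lam'. 0 < x) \<and> 2 \<le> last lam'"
proof -
  consider "\<forall>c\<le>sum_list lam. H $$ (Suc m, Suc (m + c)) = H_lam lam $$ (0, c)"
    | "\<forall>c\<le>sum_list lam. H $$ (Suc m, Suc (m + c)) = 1 - H_lam lam $$ (0, c)"
    using T by (auto simp: tail_shape_def)
  then show ?thesis
  proof cases
    case 1
    then have "tail_shape m (Suc 0 # lam)" using T by (intro tail_shape_new_block) auto
    then show ?thesis using lam by (intro exI[of _ "Suc 0 # lam"]) auto
  next
    case 2
    obtain a ls where "lam = a # ls" using lam by (cases lam) auto
    moreover from this have "tail_shape m (Suc a # ls)"
      using T 2 by (intro tail_shape_grow_block) auto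
    ultimately show ?thesis using lam by (intro exI[of _ "Suc a # ls"]) (auto split: if_splits)
  qed
qed

text \<open>The last row has ones at most in the last two columns. Each upper row must meet it and
  also miss one of its ones, so the last row has both ones and each upper row exactly one.\<close>

lemma last_two:
  assumes n: "n = Suc (Suc k)"
  shows "H $$ (Suc k, Suc k) = 1" and "i \<le> k \<Longrightarrow> H $$ (i, Suc k) = 1 - H $$ (i, k)"
proof -
  have last_row: "c = k \<or> c = Suc k" if "c < n" "H $$ (Suc k, c) = 1" for c
    using low[of "Suc k" c] that n by (cases "c < k") auto
  have meet': "H $$ (i, k) = 1 \<or> H $$ (i, Suc k) = 1 \<and> H $$ (Suc k, Suc k) = 1"
    and differ': "H $$ (i, k) = 0 \<or> H $$ (i, Suc k) = 0 \<and> H $$ (Suc k, Suc k) = 1" if "i \<le> k" for i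
    using meet[of "Suc k" i] differ[of "Suc k" i] last_row that n by fastforce+
  show "H $$ (Suc k, Suc k) = 1" using meet'[of k] differ'[of k] by auto
  show "H $$ (i, Suc k) = 1 - H $$ (i, k)" if "i \<le> k"
    using meet'[OF that] differ'[OF that] zero_one[of i k] zero_one[of i "Suc k"] that n by auto
qed

text \<open>The last two columns alone give \<open>[Suc 0]\<close>. The corner entry makes row
  \<open>Suc k\<close> end in 0, 1, which prolongs this block, so the last part is at least 2 from
  the start.\<close>

lemma tail_shape_start:
  assumes n: "n = Suc (Suc (Suc k))" and corner: "H $$ (Suc k, Suc (Suc k)) = 1"
  shows "tail_shape k [2]"
proof -
  have lam1: "H_lam [Suc 0] $$ (0, 0) = 1" "H_lam [Suc 0] $$ (0, Suc 0) = 0"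
    "H_lam [Suc 0] $$ (Suc 0, 0) = 1" "H_lam [Suc 0] $$ (Suc 0, Suc 0) = 1"
    by (simp_all add: H_lam_Cons H_lam_Nil)
  note two = last_two[OF n]
  have "tail_shape (Suc k) [Suc 0]"
    unfolding tail_shape_def
  proof (intro conjI allI impI)
    fix i c assume "0 < i \<and> i \<le> sum_list [Suc 0] \<and> c \<le> sum_list [Suc 0]"
    then have "i = Suc 0" "c = 0 \<or> c = Suc 0" by auto
    then show "H $$ (Suc k + i, Suc k + c) = H_lam [Suc 0] $$ (i, c)"
      using lam1 subdiag[of "Suc k"] two(1) n by auto
  next
    fix i assume i: "i \<le> Suc k"
    have "H $$ (i, Suc k) = 0 \<or> H $$ (i, Suc k) = 1" using zero_one[of i "Suc k"] i n by auto
    then show "(\<forall>c\<le>sum_list [Suc 0]. H $$ (i, Suc k + c) = H_lam [Suc 0] $$ (0, c)) \<or>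
        (\<forall>c\<le>sum_list [Suc 0]. H $$ (i, Suc k + c) = 1 - H_lam [Suc 0] $$ (0, c))"
      using lam1 two(2)[OF i] by (auto simp: all_le_Suc)
  qed (simp add: n)
  then have "tail_shape k [Suc (Suc 0)]"
  proof (rule tail_shape_grow_block)
    fix c assume "c \<le> Suc 0 + sum_list []"
    then have "c = 0 \<or> c = Suc 0" by auto
    then show "H $$ (Suc k, Suc (k + c)) = 1 - H_lam [Suc 0] $$ (0, c)"
      using corner two(2)[of "Suc k"] lam1 by auto
  qed
  then show ?thesis by (simp add: numeral_2_eq_2)
qed

lemma tail_shape_zero:
  assumes "3 \<le> n" "H $$ (n - 2, n - 1) = 1"
  shows "\<exists>lam. tail_shape 0 lam \<and> lam \<noteq> [] \<and> (\<forall>x\<in>set lam. 0 < x) \<and> 2 \<le> last lam"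
proof -
  have "n = Suc (Suc (Suc (n - 3)))" using assms by simp
  then obtain k where n: "n = Suc (Suc (Suc k))" by blast
  have "\<exists>lam. tail_shape m lam \<and> lam \<noteq> [] \<and> (\<forall>x\<in>set lam. 0 < x) \<and> 2 \<le> last lam" if "m \<le> k" for m
    using that
  proof (induction rule: inc_induct)
    case base
    have "tail_shape k [2]" using assms n by (intro tail_shape_start) auto
    then show ?case by (intro exI[of _ "[2]"]) auto
  next
    case (step m)
    then show ?case using tail_shape_step by blast
  qed
  then show ?thesis by blast
qed

text \<open>Only row 0 is still undecided. The complement of row 0 of \<open>H_lam lam\<close>
  vanishes on the first block and continues like row 1 after it, so it would be contained in row
  1.\<close>

lemma eq_H_lam:
  assumes T: "tail_shape 0 lam" and lam: "lam \<noteq> []" "\<forall>x\<in>set lam. 0 < x"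
  shows "H = H_lam lam"
proof -
  let ?s = "sum_list lam"
  obtain a ls where a: "lam = a # ls" "0 < a" using lam by (cases lam) auto
  have n: "n = Suc ?s" using T by (simp add: tail_shape_def)
  have rows: "H $$ (i, c) = H_lam lam $$ (i, c)" if "0 < i" "i \<le> ?s" "c \<le> ?s" for i c
    using T that by (simp add: tail_shape_def)
  have "\<forall>c\<le>?s. H $$ (0, c) = H_lam lam $$ (0, c)"
  proof (rule ccontr)
    assume "\<not> ?thesis"
    then have opp: "H $$ (0, c) = 1 - H_lam lam $$ (0, c)" if "c \<le> ?s" for c
      using T that by (auto simp: tail_shape_def)
    obtain c where c: "c < n" "H $$ (0, c) = 1" "H $$ (1, c) = 0"
      using differ[of 0 1] n a by auto
    then have "H_lam lam $$ (0, c) = 0" "H_lam lam $$ (1, c) = 0"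
      using opp[of c] rows[of 1 c] n a by auto
    then show False using a c n by (auto simp: H_lam_Cons split: if_splits)
  qed
  then have "H $$ (i, c) = H_lam lam $$ (i, c)" if "i \<le> ?s" "c \<le> ?s" for i c
    using rows that by (cases "i = 0") auto
  then show ?thesis using carrier n by (intro eq_matI) auto
qed

lemma classification:
  assumes "3 \<le> n" "H $$ (n - 2, n - 1) = 1"
  shows "\<exists>lam r. good_composition (n - 1) lam \<and> swap_rows_cols r False H = H_lam lam"
proof -
  obtain lam where T: "tail_shape 0 lam" and lam: "lam \<noteq> []" "\<forall>x\<in>set lam. 0 < x" "2 \<le> last lam"
    using tail_shape_zero[OF assms] by blast
  have H: "H = H_lam lam" by (rule eq_H_lam[OF T lam(1,2)])
  have sum: "sum_list lam = n - 1" using T by (auto simp: tail_shape_def)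
  show ?thesis
  proof (cases "2 \<le> hd lam")
    case True
    have "swap_rows_cols False False H = H" by (intro eq_matI) (auto simp: swap_rows_cols_def)
    then show ?thesis using True lam sum H by (auto simp: good_composition_def)
  next
    case False
    \<comment> \<open>A first part 1 is not the last part, which is at least 2, so a second part
      exists; the row exchange merges the two.\<close>
    then obtain a ls where "lam = Suc 0 # a # ls"
      using lam by (cases lam; cases "tl lam") (auto simp: less_Suc_eq_0_disj not_le numeral_2_eq_2)
    then have "swap_rows_cols True False H = H_lam (Suc a # ls)"
      "good_composition (n - 1) (Suc a # ls)"
      using lam sum H by (auto simp: good_composition_def swap_rows_H_lam split: if_splits)
    then show ?thesis by blast
  qed
qed

end

section \<open>Acute matrices, up to the exchange of the last two columns\<close>

lemma acute_hessenberg_classification: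
  assumes n: "3 \<le> n" and H: "H \<in> carrier_mat n n" and hess: "unreduced_hessenberg H"
    and zo: "zero_one_mat H" and ac: "acute_simplex H"
  shows "\<exists>lam r c. good_composition (n - 1) lam \<and> swap_rows_cols r c H = H_lam lam"
proof -
  have zo': "H $$ (i, j) = 0 \<or> H $$ (i, j) = 1" if "i < n" "j < n" for i j
    using zo H that by (auto simp: zero_one_mat_def)
  interpret crossing_hessenberg n H
  proof
    fix j assume "Suc j < n"
    then show "H $$ (Suc j, j) = 1" using hess H zo'[of "Suc j" j] by (auto simp: unreduced_hessenberg_def)
  next
    fix i j assume "i < n" "Suc j < i"
    then show "H $$ (i, j) = 0" using hess H by (auto simp: unreduced_hessenberg_def)
  qed (use H zo' acute_rows[OF H zo ac] in auto)
  have "n = Suc (Suc (n - 2))" "0 < n - 2" using n by simp_all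
  then obtain k where k: "n = Suc (Suc k)" "0 < k" by blast
  show ?thesis
  proof (cases "H $$ (k, Suc k) = 1")
    case True
    then show ?thesis using classification n k by fastforce
  next
    case False
    \<comment> \<open>Row \<open>k\<close> has exactly one 1 in the last two columns. Here it is in
      column \<open>k\<close>, and exchanging the columns moves it to the place where the induction
      starts.\<close>
    then have corner: "H $$ (k, k) = 1"
      using last_two(2)[OF k(1), of k] zero_one[of k k] k by auto
    define p where "p j = (if j = Suc k then k else if j = k then Suc k else j)" for j
    define H' where "H' = swap_rows_cols False True H"
    have H': "H' \<in> carrier_mat n n" using H by (simp add: H'_def swap_rows_cols_def)
    have ent: "H' $$ (i, j) = H $$ (i, p j)" if "i < n" "j < n" for i j
      using that H k by (auto simp: H'_def swap_rows_cols_def p_def)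
    have p: "p j < n" "p (p j) = j" if "j < n" for j using that k by (auto simp: p_def)
    interpret H': crossing_hessenberg n H'
    proof
      fix i j assume ij: "i < n" "Suc j < i"
      then have "p j = j" using k by (auto simp: p_def)
      then show "H' $$ (i, j) = 0" using low ij by (simp add: ent)
    next
      fix j assume j: "Suc j < n"
      show "H' $$ (Suc j, j) = 1"
      proof (cases "j = k")
        case True
        \<comment> \<open>The last subdiagonal entry now comes from the bottom right entry of
          \<open>H\<close>, which is also 1.\<close>
        then show ?thesis using last_two(1)[OF k(1)] k by (simp add: ent p_def)
      next
        case False
        then show ?thesis using j subdiag k by (auto simp: ent p_def)
      qed
    next
      fix i j assume ij: "i < n" "j < n" "i \<noteq> j"
      obtain c where "c < n" "H $$ (i, c) = 1" "H $$ (j, c) = 1" using meet[OF ij] by blast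
      then show "\<exists>c<n. H' $$ (i, c) = 1 \<and> H' $$ (j, c) = 1"
        using p ij by (intro exI[of _ "p c"]) (simp add: ent)
    next
      fix i j assume ij: "i < n" "j < n" "i \<noteq> j"
      obtain c where "c < n" "H $$ (i, c) = 1" "H $$ (j, c) = 0" using differ[OF ij] by blast
      then show "\<exists>c<n. H' $$ (i, c) = 1 \<and> H' $$ (j, c) = 0"
        using p ij by (intro exI[of _ "p c"]) (simp add: ent)
    qed (use H' p zero_one in \<open>auto simp: ent\<close>)
    have "H' $$ (n - 2, n - 1) = 1" using corner k by (simp add: ent p_def)
    then obtain lam r where "good_composition (n - 1) lam" "swap_rows_cols r False H' = H_lam lam"
      using H'.classification n by blast
    moreover have "swap_rows_cols r False H' = swap_rows_cols r True H" for r
      using H k by (intro eq_matI) (auto simp: H'_def swap_rows_cols_def)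
    ultimately show ?thesis by metis
  qed
qed

theorem theorem1p2:
  fixes n :: nat
  assumes "n \<ge> 3"
  shows "(\<forall>H :: real mat. H \<in> carrier_mat n n \<and> unreduced_hessenberg H \<and> zero_one_mat H \<and>
            acute_simplex H \<longrightarrow>
            (\<exists>lam r c. good_composition (n - 1) lam \<and> swap_rows_cols r c H = H_lam lam))
       \<and> (\<forall>lam. good_composition (n - 1) lam \<longrightarrow>
            (\<exists>f g :: nat. coprime f g \<and> real f / real g = cont_frac lam \<and>
               \<bar>det (H_lam lam)\<bar> = real f))
       \<and> (\<forall>lam. good_composition (n - 1) lam \<longrightarrow>
            strictly_ultrametric (gram (H_lam lam)) \<and> acute_simplex (H_lam lam))"
proof (intro conjI allI impI)
  fix H :: "real mat"
  assume "H \<in> carrier_mat n n \<and> unreduced_hessenberg H \<and> zero_one_mat H \<and> acute_simplex H"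
  then show "\<exists>lam r c. good_composition (n - 1) lam \<and> swap_rows_cols r c H = H_lam lam"
    using acute_hessenberg_classification[OF assms] by blast
next
  fix lam assume "good_composition (n - 1) lam"
  then have "\<forall>x\<in>set lam. 0 < x" by (rule good_compositionD)
  from kvec_continuants[OF this] show "\<exists>f g :: nat. coprime f g \<and> real f / real g = cont_frac lam \<and>
      \<bar>det (H_lam lam)\<bar> = real f"
    unfolding abs_det_H_lam by (auto simp: abs_mult power_abs)
qed (blast intro: strictly_ultrametric_gram_H_lam acute_simplex_H_lam)+

end
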